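(* Let $n\ge1$, $s\in(0,1/n]$, and let $\mu$ be an $s$-concave probability measure on $\mathbb{R}^n$ supported on a convex body $K$. Then the function $q_\mu^s$ is concave on $K$.
   Context: A convex body in $\mathbb{R}^n$ is a compact convex set with non-empty interior. A Borel probability measure $\mu$ on $\mathbb{R}^n$ is $s$-concave, $s\in(0,1/n]$, if it is full-dimensional (i.e. $\mu(H)<1$ for every hyperplane $H$) and $\mu((1-\lambda)A+\lambda B)^s\geq(1-\lambda)\mu(A)^s+\lambda\mu(B)^s$ for all compact sets $A,B\subseteq\mathbb{R}^n$ with $\mu(A)\mu(B)>0$ and all $\lambda\in[0,1]$. "Supported on $K$" means that the support of $\mu$ is $K$. The Tukey half-space depth is $q_\mu(x)=\inf_{u\in S^{n-1}}\mu(\{y\in\mathbb{R}^n:\langle y,u\rangle\geq\langle x,u\rangle\})$, where $S^{n-1}$ is the Euclidean unit sphere. *)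

theory Defs
  imports "HOL-Analysis.Analysis" "HOL-Probability.Probability_Measure"
begin

definition convex_body :: "'a::euclidean_space set \<Rightarrow> bool" where
  "convex_body K \<longleftrightarrow> compact K \<and> convex K \<and> interior K \<noteq> {}"

definition measure_support :: "'a::topological_space measure \<Rightarrow> 'a set" where
  "measure_support \<mu> = {x. \<forall>U. open U \<longrightarrow> x \<in> U \<longrightarrow> measure \<mu> U > 0}"

definition borel_probability :: "'a::topological_space measure \<Rightarrow> bool" where
  "borel_probability \<mu> \<longleftrightarrow> prob_space \<mu> \<and> sets \<mu> = sets borel"

definition full_dimensional :: "'a::euclidean_space measure \<Rightarrow> bool" where
  "full_dimensional \<mu> \<longleftrightarrow> (\<forall>a b. a \<noteq> 0 \<longrightarrow> measure \<mu> {x. a \<bullet> x = b} < 1)"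

text \<open>The set comprehension is the Minkowski combination of \<open>A\<close> and \<open>B\<close>, which is again
  compact and hence Borel.  The powers are real powers of nonnegative numbers with positive
  exponent, for which \<open>0 powr s = 0\<close> agrees with the usual convention.\<close>

definition s_concave :: "real \<Rightarrow> 'a::euclidean_space measure \<Rightarrow> bool" where
  "s_concave s \<mu> \<longleftrightarrow> full_dimensional \<mu> \<and>
     (\<forall>A B l. compact A \<longrightarrow> compact B \<longrightarrow> measure \<mu> A * measure \<mu> B > 0 \<longrightarrow> l \<in> {0..1} \<longrightarrow>
        measure \<mu> {(1 - l) *\<^sub>R a + l *\<^sub>R b | a b. a \<in> A \<and> b \<in> B} powr s
          \<ge> (1 - l) * measure \<mu> A powr s + l * measure \<mu> B powr s)"

definition tukey_depth :: "'a::euclidean_space measure \<Rightarrow> 'a \<Rightarrow> real" where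
  "tukey_depth \<mu> x = (INF u\<in>sphere 0 1. measure \<mu> {y. y \<bullet> u \<ge> x \<bullet> u})"

end

theory Submission
  imports Defs
begin

text \<open>
  Fix a direction \<open>u\<close>.  Applied to the parts \<open>A\<close> and \<open>B\<close> of \<open>K\<close> in the half-spaces with normal
  \<open>u\<close> through \<open>x\<close> and \<open>y\<close>, \<open>s\<close>-concavity bounds the mass of the half-space through
  \<open>(1 - l) x + l y\<close> from below, because that half-space contains \<open>(1 - l) A + l B\<close>.  So the
  \<open>s\<close>-th power of the mass is concave along every direction (\<open>halfspace_mass_powr_concave\<close>),
  and an infimum of concave functions is concave.

  The obstacle is that \<open>s\<close>-concavity speaks only of sets of positive measure, whereas \<open>A\<close> or \<open>B\<close>
  may be null, for example when \<open>u\<close> is an outer normal of \<open>K\<close> at \<open>x\<close>.  Here the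
  points of the support matter: shifting the half-spaces outwards by \<open>\<epsilon> > 0\<close> puts \<open>x\<close> and \<open>y\<close> in
  their interiors, so that their masses become positive.  The limit \<open>\<epsilon> \<rightarrow> 0\<close> is then
  taken only in the half-space through \<open>(1 - l) x + l y\<close>, by continuity from above.
\<close>

text \<open>
  The complement of the support is covered by open null sets, and in a second countable space
  countably many of them suffice.
\<close>

lemma measure_support_eq_1:
  fixes \<mu> :: "'a::second_countable_topology measure"
  assumes "borel_probability \<mu>" and "closed (measure_support \<mu>)"
  shows "measure \<mu> (measure_support \<mu>) = 1"
proof -
  interpret prob_space \<mu>
    using assms(1) by (simp add: borel_probability_def)
  have sets [simp]: "sets \<mu> = sets borel"
    using assms(1) by (simp add: borel_probability_def)
  have space: "space \<mu> = UNIV"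
    using sets_eq_imp_space_eq[OF sets] by simp
  define \<F> where "\<F> = {U. open U \<and> measure \<mu> U = 0}"
  have open_\<F>: "\<And>U. U \<in> \<F> \<Longrightarrow> open U"
    by (simp add: \<F>_def)
  obtain \<G> where \<G>: "\<G> \<subseteq> \<F>" "countable \<G>" "\<Union>\<G> = \<Union>\<F>"
    using Lindelof[OF open_\<F>] by blast
  have "U \<in> null_sets \<mu>" if "U \<in> \<G>" for U
    using that \<G>(1) by (intro null_setsI) (auto simp: \<F>_def emeasure_eq_measure)
  then have "\<Union>\<G> \<in> null_sets \<mu>"
    using null_sets_UN'[OF \<G>(2), of "\<lambda>U. U"] by simp
  moreover have "- measure_support \<mu> = \<Union>\<F>"
    by (auto simp: measure_support_def \<F>_def zero_less_measure_iff)
  ultimately have "measure \<mu> (space \<mu> - measure_support \<mu>) = 0"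
    using \<G>(3) by (simp add: space Compl_eq_Diff_UNIV[symmetric] measure_eq_0_null_sets)
  then show ?thesis
    using prob_compl[of "measure_support \<mu>"] assms(2) by simp
qed

lemma halfspace_mass_powr_concave:
  fixes \<mu> :: "'a::euclidean_space measure"
  assumes "borel_probability \<mu>" and "s_concave s \<mu>" and "0 < s"
    and "compact (measure_support \<mu>)"
    and x: "x \<in> measure_support \<mu>" and y: "y \<in> measure_support \<mu>" and l: "l \<in> {0..1}"
  shows "(1 - l) * measure \<mu> {w. w \<bullet> u \<ge> x \<bullet> u} powr s + l * measure \<mu> {w. w \<bullet> u \<ge> y \<bullet> u} powr s
    \<le> measure \<mu> {w. w \<bullet> u \<ge> ((1 - l) *\<^sub>R x + l *\<^sub>R y) \<bullet> u} powr s"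
    (is "?c \<le> measure \<mu> {w. w \<bullet> u \<ge> ?z \<bullet> u} powr s")
proof -
  interpret prob_space \<mu>
    using assms(1) by (simp add: borel_probability_def)
  have sets [simp]: "sets \<mu> = sets borel"
    using assms(1) by (simp add: borel_probability_def)
  have space: "space \<mu> = UNIV"
    using sets_eq_imp_space_eq[OF sets] by simp
  define K where "K = measure_support \<mu>"
  have "compact K" and "closed K"
    using assms(4) by (auto simp: K_def compact_imp_closed)
  have K1: "measure \<mu> K = 1"
    unfolding K_def using assms(1) \<open>closed K\<close> by (intro measure_support_eq_1) (auto simp: K_def)
  have closed_halfspace: "closed {w. w \<bullet> u \<ge> t}" for t
    by (simp add: closed_Collect_le continuous_on_inner)
  have mass_in_K: "measure \<mu> (K \<inter> S) = measure \<mu> S" if "closed S" for S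
  proof -
    have "AE w in \<mu>. w \<in> K"
      using K1 \<open>closed K\<close> by (intro AE_prob_1) simp_all
    then show ?thesis
      using that \<open>closed K\<close> by (intro finite_measure_eq_AE) auto
  qed
  have pos: "measure \<mu> {w. w \<bullet> u \<ge> p \<bullet> u - \<epsilon>} > 0" if "p \<in> K" "\<epsilon> > 0" for p \<epsilon>
  proof -
    have "open {w. w \<bullet> u > p \<bullet> u - \<epsilon>}"
      by (intro open_Collect_less continuous_intros)
    then have "measure \<mu> {w. w \<bullet> u > p \<bullet> u - \<epsilon>} > 0"
      using that by (auto simp: K_def measure_support_def)
    also have "\<dots> \<le> measure \<mu> {w. w \<bullet> u \<ge> p \<bullet> u - \<epsilon>}"
      using closed_halfspace by (intro finite_measure_mono) auto
    finally show ?thesis .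
  qed
  have shifted: "?c \<le> measure \<mu> {w. w \<bullet> u \<ge> ?z \<bullet> u - \<epsilon>} powr s" if \<epsilon>: "\<epsilon> > 0" for \<epsilon>
  proof -
    \<comment> \<open>Cutting with the compact set \<open>K\<close>, which carries all the mass, makes the half-spaces compact
      without changing their measure.\<close>
    define H where "H p = K \<inter> {w. w \<bullet> u \<ge> p \<bullet> u - \<epsilon>}" for p
    define M where "M = {(1 - l) *\<^sub>R a + l *\<^sub>R b | a b. a \<in> H x \<and> b \<in> H y}"
    have compact_H: "compact (H p)" for p
      unfolding H_def using \<open>compact K\<close> closed_halfspace by (rule compact_Int_closed)
    have measure_H: "measure \<mu> (H p) = measure \<mu> {w. w \<bullet> u \<ge> p \<bullet> u - \<epsilon>}" for p
      unfolding H_def by (rule mass_in_K[OF closed_halfspace])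
    have H_ge: "measure \<mu> {w. w \<bullet> u \<ge> p \<bullet> u} powr s \<le> measure \<mu> (H p) powr s" for p
      unfolding measure_H using \<open>0 < s\<close> \<epsilon> closed_halfspace
      by (intro powr_mono2 finite_measure_mono) auto
    have "?c \<le> (1 - l) * measure \<mu> (H x) powr s + l * measure \<mu> (H y) powr s"
      using l by (intro add_mono mult_left_mono H_ge) auto
    also have "\<dots> \<le> measure \<mu> M powr s"
    proof -
      have "measure \<mu> (H x) * measure \<mu> (H y) > 0"
        using x y pos[OF _ \<epsilon>] by (simp add: measure_H K_def)
      with assms(2) l compact_H show ?thesis
        unfolding s_concave_def M_def by blast
    qed
    also have "\<dots> \<le> measure \<mu> {w. w \<bullet> u \<ge> ?z \<bullet> u - \<epsilon>} powr s"
    proof -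
      have "M \<subseteq> {w. w \<bullet> u \<ge> ?z \<bullet> u - \<epsilon>}"
      proof
        fix w assume "w \<in> M"
        then obtain a b where w: "w = (1 - l) *\<^sub>R a + l *\<^sub>R b" and "a \<in> H x" "b \<in> H y"
          unfolding M_def by blast
        then have "(1 - l) * (x \<bullet> u - \<epsilon>) + l * (y \<bullet> u - \<epsilon>) \<le> (1 - l) * (a \<bullet> u) + l * (b \<bullet> u)"
          using l by (intro add_mono mult_left_mono) (auto simp: H_def)
        then show "w \<in> {w. w \<bullet> u \<ge> ?z \<bullet> u - \<epsilon>}"
          by (simp add: w inner_add_left algebra_simps)
      qed
      then show ?thesis
        using \<open>0 < s\<close> closed_halfspace by (intro powr_mono2 finite_measure_mono) auto
    qed
    finally show ?thesis .
  qed
  define S where "S i = {w. w \<bullet> u \<ge> ?z \<bullet> u - 1 / real (Suc i)}" for i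
  have "(\<Inter>i. S i) = {w. w \<bullet> u \<ge> ?z \<bullet> u}"
  proof (intro equalityI subsetI)
    fix w assume "w \<in> (\<Inter>i. S i)"
    then have le: "?z \<bullet> u - 1 / real (Suc i) \<le> w \<bullet> u" for i
      by (auto simp: S_def)
    have "(\<lambda>i. ?z \<bullet> u - 1 / real (Suc i)) \<longlonglongrightarrow> ?z \<bullet> u - 0"
      by (intro tendsto_diff tendsto_const LIMSEQ_Suc[OF lim_1_over_n])
    then show "w \<in> {w. w \<bullet> u \<ge> ?z \<bullet> u}"
      using LIMSEQ_le_const2 le by fastforce
  next
    fix w assume "w \<in> {w. w \<bullet> u \<ge> ?z \<bullet> u}"
    moreover have "0 \<le> 1 / real (Suc i)" for i by simp
    ultimately show "w \<in> (\<Inter>i. S i)"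
      unfolding S_def by (smt (verit) INT_I mem_Collect_eq)
  qed
  moreover have "decseq S"
    unfolding S_def decseq_def by (force simp: frac_le intro: order_trans[rotated])
  moreover have "range S \<subseteq> sets \<mu>"
    using closed_halfspace by (auto simp: S_def)
  ultimately have "(\<lambda>i. measure \<mu> (S i)) \<longlonglongrightarrow> measure \<mu> {w. w \<bullet> u \<ge> ?z \<bullet> u}"
    using finite_Lim_measure_decseq[of S] by simp
  then have "(\<lambda>i. measure \<mu> (S i) powr s) \<longlonglongrightarrow> measure \<mu> {w. w \<bullet> u \<ge> ?z \<bullet> u} powr s"
    using \<open>0 < s\<close> by (intro tendsto_powr') auto
  moreover have "?c \<le> measure \<mu> (S i) powr s" for i
    unfolding S_def by (rule shifted) simp
  ultimately show ?thesis
    by (intro LIMSEQ_le_const) auto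
qed

text \<open>
  The infimum is taken before the power, so the bound is first transported by the inverse power
  \<open>1 / s\<close> and compared with the masses themselves.
\<close>

lemma tukey_depth_powr_ge:
  fixes \<mu> :: "'a::euclidean_space measure"
  assumes "0 < s" and "0 \<le> c"
    and "\<And>u. u \<in> sphere 0 1 \<Longrightarrow> c \<le> measure \<mu> {y. y \<bullet> u \<ge> z \<bullet> u} powr s"
  shows "c \<le> tukey_depth \<mu> z powr s"
proof -
  have "c powr (1 / s) \<le> tukey_depth \<mu> z"
    unfolding tukey_depth_def
  proof (rule cINF_greatest)
    fix u :: 'a assume "u \<in> sphere 0 1"
    then have "c powr (1 / s) \<le> (measure \<mu> {y. y \<bullet> u \<ge> z \<bullet> u} powr s) powr (1 / s)"
      using assms by (intro powr_mono2) auto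
    then show "c powr (1 / s) \<le> measure \<mu> {y. y \<bullet> u \<ge> z \<bullet> u}"
      using \<open>0 < s\<close> by (simp add: powr_powr)
  qed simp
  then have "(c powr (1 / s)) powr s \<le> tukey_depth \<mu> z powr s"
    using \<open>0 < s\<close> by (intro powr_mono2) auto
  then show ?thesis
    using assms(1,2) by (simp add: powr_powr)
qed

lemma tukey_depth_powr_le:
  fixes \<mu> :: "'a::euclidean_space measure"
  assumes "0 < s" and "u \<in> sphere 0 1"
  shows "tukey_depth \<mu> x powr s \<le> measure \<mu> {y. y \<bullet> u \<ge> x \<bullet> u} powr s"
proof (rule powr_mono2)
  show "0 \<le> tukey_depth \<mu> x"
    unfolding tukey_depth_def by (intro cINF_greatest) auto
  show "tukey_depth \<mu> x \<le> measure \<mu> {y. y \<bullet> u \<ge> x \<bullet> u}"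
    unfolding tukey_depth_def using assms(2)
    by (intro cINF_lower bdd_belowI[where m = 0]) auto
qed (use assms(1) in simp)

theorem lemma7p2:
  fixes \<mu> :: "(real ^ 'n) measure" and K :: "(real ^ 'n) set" and s :: real
  assumes "0 < s" and "s \<le> 1 / real CARD('n)"
    and "borel_probability \<mu>"
    and "s_concave s \<mu>"
    and "convex_body K"
    and "measure_support \<mu> = K"
  shows "concave_on K (\<lambda>x. tukey_depth \<mu> x powr s)"
  unfolding concave_on_iff
proof (intro conjI ballI allI impI)
  show "convex K"
    using assms(5) by (simp add: convex_body_def)
next
  fix x y :: "real ^ 'n" and k l :: real
  assume "x \<in> K" "y \<in> K" "0 \<le> k" "0 \<le> l" "k + l = 1"
  then have k: "k = 1 - l" and l: "l \<in> {0..1}"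
    by auto
  show "k * tukey_depth \<mu> x powr s + l * tukey_depth \<mu> y powr s
    \<le> tukey_depth \<mu> (k *\<^sub>R x + l *\<^sub>R y) powr s"
  proof (rule tukey_depth_powr_ge)
    fix u :: "real ^ 'n" assume u: "u \<in> sphere 0 1"
    have "k * tukey_depth \<mu> x powr s + l * tukey_depth \<mu> y powr s
      \<le> k * measure \<mu> {w. w \<bullet> u \<ge> x \<bullet> u} powr s + l * measure \<mu> {w. w \<bullet> u \<ge> y \<bullet> u} powr s"
      using \<open>0 \<le> k\<close> \<open>0 \<le> l\<close> assms(1) u
      by (intro add_mono mult_left_mono tukey_depth_powr_le)
    also have "\<dots> \<le> measure \<mu> {w. w \<bullet> u \<ge> (k *\<^sub>R x + l *\<^sub>R y) \<bullet> u} powr s"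
      unfolding k using assms \<open>x \<in> K\<close> \<open>y \<in> K\<close> l
      by (intro halfspace_mass_powr_concave) (auto simp: convex_body_def)
    finally show "k * tukey_depth \<mu> x powr s + l * tukey_depth \<mu> y powr s
      \<le> measure \<mu> {w. w \<bullet> u \<ge> (k *\<^sub>R x + l *\<^sub>R y) \<bullet> u} powr s" .
  qed (use assms(1) \<open>0 \<le> k\<close> \<open>0 \<le> l\<close> in auto)
qed

end
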